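(* Consider the infinite chessboard with rows and columns indexed by $\mathbb{Z}$. Choose any integers $y_{ij}$ for all squares $(i,j)$ with $i\in\{0,1\}$ or $j\in\{0,1\}$ (two adjacent full rows and two adjacent full columns). Then there is a unique assignment $(x_{ij})_{i,j\in\mathbb{Z}}$ of integers satisfying the neighbor-sum property such that $x_{ij}=y_{ij}$ whenever $i\in\{0,1\}$ or $j\in\{0,1\}$.
   Context: An infinite chessboard is an assignment of an integer $x_{ij}$ to each square $(i,j)\in\mathbb{Z}\times\mathbb{Z}$. Two distinct squares $(i,j)\ne(i',j')$ are neighbors if $|i-i'|\le1$ and $|j-j'|\le1$. The board satisfies the neighbor-sum property if the number on each square equals the sum of the numbers on all its (eight) neighboring squares. *)

theory Defs
  imports Main
begin

type_synonym board = "int \<Rightarrow> int \<Rightarrow> int"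

definition neighbors :: "int \<Rightarrow> int \<Rightarrow> (int \<times> int) set" where
  "neighbors i j = {(i', j'). (i', j') \<noteq> (i, j) \<and> \<bar>i - i'\<bar> \<le> 1 \<and> \<bar>j - j'\<bar> \<le> 1}"

(* HOL sums over infinite sets are 0, so this guarantees that sums over neighbors are genuine. *)
lemma finite_neighbors [simp]: "finite (neighbors i j)"
proof (rule finite_subset)
  show "neighbors i j \<subseteq> {i - 1..i + 1} \<times> {j - 1..j + 1}"
    by (auto simp: neighbors_def)
qed simp

definition neighbor_sum :: "board \<Rightarrow> bool" where
  "neighbor_sum x \<longleftrightarrow> (\<forall>i j. x i j = (\<Sum>(i', j') \<in> neighbors i j. x i' j'))"

end

(* Each square (i, j) is the center of exactly one equation of the neighbor-sum property. Solve this
   equation for the corner pointing away from the given cross. The resulting corners are exactly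
   the squares off the cross, each occurring once, and the eight other squares of the 3x3 block are
   closer to the cross, so the property is a well-founded recursion with the cross as its base. *)

theory Submission
  imports Defs
begin

text \<open>The direction away from {0, 1}, fixed as -1 at 0 and as 1 at 1, so that centers on the
  cross also have an outward corner.\<close>

definition outward :: "int \<Rightarrow> int" where
  "outward i = (if i \<ge> 1 then 1 else - 1)"

text \<open>Distance to {0, 1}.\<close>

definition depth :: "int \<Rightarrow> nat" where
  "depth i = nat (if i \<ge> 1 then i - 1 else - i)"

text \<open>The equation centered at \<open>(i - s, j - t)\<close>, solved for its corner
  \<open>(i, j)\<close>.\<close>

definition corner_value :: "board \<Rightarrow> int \<Rightarrow> int \<Rightarrow> int" where
  "corner_value x i j = (let s = outward i; t = outward j in
     x (i - s) (j - t)
     - x i (j - t) - x i (j - 2 * t)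
     - x (i - s) j - x (i - s) (j - 2 * t)
     - x (i - 2 * s) j - x (i - 2 * s) (j - t) - x (i - 2 * s) (j - 2 * t))"

text \<open>Arbitrary signs \<open>s\<close>, \<open>t\<close> treat all four quadrants at
  once.\<close>

lemma neighbors_eq:
  assumes "\<bar>s\<bar> = 1" "\<bar>t\<bar> = 1"
  shows "neighbors i j = {(i + s, j + t), (i + s, j), (i + s, j - t), (i, j + t), (i, j - t),
    (i - s, j + t), (i - s, j), (i - s, j - t)}"
proof -
  have near: "\<bar>k - k'\<bar> \<le> 1 \<longleftrightarrow> k' = k + a \<or> k' = k \<or> k' = k - a" if "\<bar>a\<bar> = 1" for k k' a :: int
    using that by linarith
  have "k + a \<noteq> k" "k - a \<noteq> k" if "\<bar>a\<bar> = 1" for k a :: int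
    using that by auto
  note this[OF assms(1), of i] this[OF assms(2), of j]
  then show ?thesis
    unfolding neighbors_def near[OF assms(1), of i] near[OF assms(2), of j]
    by (simp only: set_eq_iff split_paired_All mem_Collect_eq case_prod_conv insert_iff empty_iff prod.inject) metis
qed

lemma sum_neighbors:
  fixes x :: board
  assumes "\<bar>s\<bar> = 1" "\<bar>t\<bar> = 1"
  shows "(\<Sum>(i', j') \<in> neighbors i j. x i' j') =
    x (i + s) (j + t) + x (i + s) j + x (i + s) (j - t) + x i (j + t) + x i (j - t)
    + x (i - s) (j + t) + x (i - s) j + x (i - s) (j - t)"
proof -
  \<comment> \<open>These make the eight listed squares distinct, so no term of the sum is
    lost.\<close>
  have "s \<noteq> 0" "t \<noteq> 0" "s \<noteq> - s" "t \<noteq> - t" using assms by auto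
  then show ?thesis unfolding neighbors_eq[OF assms] by simp
qed

lemma abs_outward [simp]: "\<bar>outward i\<bar> = 1"
  by (simp add: outward_def)

text \<open>Moving each coordinate \<open>k\<close> to \<open>k + outward k\<close> matches centers
  with squares off the cross, so both sides are the same family of equations.\<close>

lemma neighbor_sum_iff_corner_value:
  "neighbor_sum x \<longleftrightarrow> (\<forall>i j. i \<notin> {0, 1} \<and> j \<notin> {0, 1} \<longrightarrow> x i j = corner_value x i j)"
  (is "_ \<longleftrightarrow> ?R")
proof
  assume sum: "neighbor_sum x"
  show ?R
  proof (intro allI impI)
    fix i j :: int
    let ?s = "outward i" and ?t = "outward j"
    have "x (i - ?s) (j - ?t) = (\<Sum>(i', j') \<in> neighbors (i - ?s) (j - ?t). x i' j')"
      using sum unfolding neighbor_sum_def by blast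
    then show "x i j = corner_value x i j"
      by (simp add: sum_neighbors[of ?s ?t] corner_value_def Let_def diff_diff_eq)
  qed
next
  assume corner: ?R
  show "neighbor_sum x"
    unfolding neighbor_sum_def
  proof (intro allI)
    fix i j :: int
    let ?s = "outward i" and ?t = "outward j"
    \<comment> \<open>The outward corner lies off the cross and has the same directions as its
      center, so stepping back from it returns to \<open>(i, j)\<close>.\<close>
    have off: "k + outward k \<notin> {0, 1}" "outward (k + outward k) = outward k" for k
      by (auto simp: outward_def)
    have "x (i + ?s) (j + ?t) = corner_value x (i + ?s) (j + ?t)"
      using corner off(1) by blast
    moreover have "k + a - 2 * a = k - a" for k a :: int by simp
    ultimately show "x i j = (\<Sum>(i', j') \<in> neighbors i j. x i' j')"
      by (simp add: sum_neighbors[of ?s ?t] corner_value_def Let_def off(2))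
  qed
qed

text \<open>Two adjacent base lines suffice: a double step from 2 or -1 ends at 0 or 1, of depth
  0.\<close>

lemma depth_decreasing:
  assumes "i \<notin> {0, 1}"
  shows "depth (i - outward i) < depth i" "depth (i - 2 * outward i) < depth i"
  using assms by (auto simp: depth_def outward_def)

text \<open>Each square read by \<open>corner_value\<close> has at least one coordinate moved inward
  and none moved outward, so its total depth is smaller.\<close>

lemma corner_value_cong:
  assumes "i \<notin> {0, 1}" "j \<notin> {0, 1}"
    and "\<And>i' j'. depth i' + depth j' < depth i + depth j \<Longrightarrow> x i' j' = z i' j'"
  shows "corner_value x i j = corner_value z i j"
proof -
  note depth_decreasing[OF assms(1)] depth_decreasing[OF assms(2)]
  then show ?thesis
    unfolding corner_value_def Let_def by (simp add: assms(3) add_strict_mono)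
qed

lemma ex_corner_recursion:
  fixes y :: board
  shows "\<exists>x. \<forall>i j. x i j = (if i \<in> {0, 1} \<or> j \<in> {0, 1} then y i j else corner_value x i j)"
proof -
  let ?R = "measure (\<lambda>(i, j). depth i + depth j)"
  define F where "F = (\<lambda>g (i, j). if i \<in> {0, 1} \<or> j \<in> {0, 1} then y i j
    else corner_value (curry g) i j)"
  \<comment> \<open>\<open>F\<close> reads its argument only at squares of smaller total depth, so
    well-founded recursion yields a fixed point.\<close>
  have "adm_wf ?R F"
    unfolding adm_wf_def F_def by (auto intro: corner_value_cong)
  then have "wfrec ?R F = F (wfrec ?R F)"
    by (intro ext wfrec_fixpoint[THEN fun_cong]) auto
  then have "curry (wfrec ?R F) i j = F (wfrec ?R F) (i, j)" for i j
    by (metis curry_conv)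
  then show ?thesis
    unfolding F_def by (intro exI[of _ "curry (wfrec ?R F)"]) (simp add: F_def)
qed

text \<open>By induction on total depth, both boards apply \<open>corner_value\<close> to values
  that already agree.\<close>

lemma corner_recursion_unique:
  fixes x z :: board
  assumes "\<And>i j. i \<in> {0, 1} \<or> j \<in> {0, 1} \<Longrightarrow> x i j = z i j"
    and "\<And>i j. i \<notin> {0, 1} \<Longrightarrow> j \<notin> {0, 1} \<Longrightarrow> x i j = corner_value x i j"
    and "\<And>i j. i \<notin> {0, 1} \<Longrightarrow> j \<notin> {0, 1} \<Longrightarrow> z i j = corner_value z i j"
  shows "x i j = z i j"
proof (induction "depth i + depth j" arbitrary: i j rule: less_induct)
  case less
  show ?case
  proof (cases "i \<in> {0, 1} \<or> j \<in> {0, 1}")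
    case True
    then show ?thesis by (rule assms(1))
  next
    case False
    then have "corner_value x i j = corner_value z i j"
      using less by (intro corner_value_cong) auto
    with False show ?thesis using assms(2,3)[of i j] by simp
  qed
qed

theorem mainTheorem9:
  fixes y :: board
  shows "\<exists>!x :: board. neighbor_sum x \<and>
    (\<forall>i j. i \<in> {0, 1} \<or> j \<in> {0, 1} \<longrightarrow> x i j = y i j)"
proof (rule ex_ex1I)
  obtain x where x: "\<And>i j. x i j = (if i \<in> {0, 1} \<or> j \<in> {0, 1} then y i j else corner_value x i j)"
    using ex_corner_recursion by blast
  have "x i j = y i j" if "i \<in> {0, 1} \<or> j \<in> {0, 1}" for i j
    using that by (simp add: x[of i j])
  moreover have "x i j = corner_value x i j" if "i \<notin> {0, 1} \<and> j \<notin> {0, 1}" for i j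
    using that by (simp add: x[of i j])
  then have "neighbor_sum x"
    unfolding neighbor_sum_iff_corner_value by blast
  ultimately show "\<exists>x. neighbor_sum x \<and> (\<forall>i j. i \<in> {0, 1} \<or> j \<in> {0, 1} \<longrightarrow> x i j = y i j)"
    by blast
next
  fix x z :: board
  assume "neighbor_sum x \<and> (\<forall>i j. i \<in> {0, 1} \<or> j \<in> {0, 1} \<longrightarrow> x i j = y i j)"
    and "neighbor_sum z \<and> (\<forall>i j. i \<in> {0, 1} \<or> j \<in> {0, 1} \<longrightarrow> z i j = y i j)"
  \<comment> \<open>Both boards equal \<open>y\<close> on the cross and obey the same recursion off
    it.\<close>
  then have "x i j = z i j" for i j
    unfolding neighbor_sum_iff_corner_value by - (rule corner_recursion_unique[of x z], metis+)
  then show "x = z" by (intro ext)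
qed

end
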